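(* The $P_2$ set $\{1,7,14\}$ is non-extendable; that is, there is no positive integer $m\notin\{1,7,14\}$ such that $\{1,7,14,m\}$ is a $P_2$ set.
   Context: Let $n$ be an integer. A set $\{a_1,\dots,a_r\}$ of $r$ distinct positive integers has the property $D(n)$, and is called a $P_n$ set of size $r$ (or a Diophantine $r$-tuple with the property $D(n)$), if $a_ia_j+n$ is a perfect square (the square of an integer) for all $1\le i<j\le r$. A $P_n$ set of size 3 is called non-extendable if it cannot be enlarged to a $P_n$ set of size 4 (a Diophantine quadruple with the property $D(n)$) by adjoining a further positive integer distinct from its elements. *)

theory Defs
  imports "HOL-Computational_Algebra.Nth_Powers"
begin

definition P_set :: "int \<Rightarrow> nat \<Rightarrow> int set \<Rightarrow> bool" where
  "P_set n r A \<longleftrightarrow>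
     finite A \<and> card A = r \<and> (\<forall>a\<in>A. 0 < a) \<and>
     (\<forall>a\<in>A. \<forall>b\<in>A. a \<noteq> b \<longrightarrow> is_square (a * b + n))"

definition non_extendable :: "int \<Rightarrow> int set \<Rightarrow> bool" where
  "non_extendable n A \<longleftrightarrow>
     P_set n 3 A \<and> \<not> (\<exists>m::int. 0 < m \<and> m \<notin> A \<and> P_set n 4 (insert m A))"

end

theory Submission
  imports Defs
begin

text \<open>
  The obstruction is congruential, so no Pell equations have to be solved. A new
  element \<open>m\<close> would make \<open>m + 2\<close>, \<open>7 * m + 2\<close> and \<open>14 * m + 2\<close> squares. Modulo 4 these
  numbers are \<open>m + 2\<close>, \<open>2 - m\<close> and \<open>2 * m + 2\<close>, while a square is 0 or 1 modulo 4. The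
  third condition forces \<open>m\<close> to be odd; the first then leaves only \<open>m \<equiv> 3\<close>, and for this
  class the second number is 3 modulo 4, which is not a square.
\<close>

lemma is_square_mod_4:
  fixes x :: int
  assumes "is_square x"
  shows "x mod 4 = 0 \<or> x mod 4 = 1"
proof -
  obtain y where x: "x = y ^ 2"
    using assms by (auto simp: is_nth_power_def)
  show ?thesis
  proof (cases "even y")
    case True
    then obtain k where "y = 2 * k" by blast
    then have "x = 4 * k ^ 2" using x by (simp add: power2_eq_square)
    then show ?thesis by simp
  next
    case False
    then obtain k where "y = 2 * k + 1" by (rule oddE)
    then have "x = 4 * (k ^ 2 + k) + 1" using x by (simp add: power2_eq_square algebra_simps)
    then show ?thesis by presburger
  qed
qed

lemma no_common_square_shift:
  fixes m :: int
  assumes "is_square (m + 2)" "is_square (7 * m + 2)" "is_square (14 * m + 2)"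
  shows False
proof -
  have "m mod 4 = 2 \<or> m mod 4 = 3"
    using is_square_mod_4[OF assms(1)] by presburger
  moreover have "m mod 4 \<noteq> 2"
    using is_square_mod_4[OF assms(3)] by presburger
  moreover have "m mod 4 \<noteq> 3"
    using is_square_mod_4[OF assms(2)] by presburger
  ultimately show False by blast
qed

lemma P_set_1_7_14: "P_set 2 3 {1, 7, 14}"
proof -
  have "is_square (9::int)" "is_square (16::int)" "is_square (100::int)"
    using is_nth_power_nth_power[of 2 "3::int"] is_nth_power_nth_power[of 2 "4::int"]
      is_nth_power_nth_power[of 2 "10::int"] by simp_all
  then show ?thesis
    by (simp add: P_set_def)
qed

theorem theorem3:
  shows "non_extendable 2 {1, 7, 14}"
proof -
  have False if "m \<notin> {1, 7, 14}" "P_set 2 4 (insert m {1, 7, 14})" for m :: int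
  proof -
    have "\<forall>a\<in>{1, 7, 14}. is_square (a * m + 2)"
      using that by (auto simp: P_set_def)
    then show False
      using no_common_square_shift[of m] by simp
  qed
  then show ?thesis
    using P_set_1_7_14 unfolding non_extendable_def by blast
qed

end
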